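(* Let $A\ge 0$ and let $G$ be an $A$-bounded graph on $n$ vertices. Then $G$ has at most $nA$ maximal cliques.
   Context: All graphs are finite, simple and undirected; $N_H(v)$ is the set of neighbors of $v$ in $H$. A graph $G$ is $A$-bounded if for every subgraph $H$ of $G$ with at least one vertex there is a vertex $v\in V(H)$ such that \[ \sum_{w\in V(H),\ w\notin N_H(v)} 3^{|N_H(v)\cap N_H(w)|/3}\le A \] (the sum ranges over all vertices $w$ of $H$ not adjacent to $v$, including $w=v$). A maximal clique is a clique not contained in any strictly larger clique. *)

theory Defs
  imports Complex_Main "Graph_Theory.Graph_Theory"
begin

text \<open>
  Finite simple undirected graphs are the \<^locale>\<open>pair_graph\<close>s: an edge between \<open>u\<close> and \<open>v\<close> is
  the pair of opposite arcs \<open>(u, v)\<close>, \<open>(v, u)\<close>.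
\<close>

definition neighbors :: "'a pair_pre_digraph \<Rightarrow> 'a \<Rightarrow> 'a set" where
  "neighbors H v = {w \<in> pverts H. (v, w) \<in> parcs H}"

text \<open>
  The subgraphs need not be induced. \<^const>\<open>subgraph\<close> alone only yields a subdigraph, hence the
  extra condition \<open>pair_graph H\<close>.
\<close>

definition bounded_graph :: "real \<Rightarrow> 'a pair_pre_digraph \<Rightarrow> bool" where
  "bounded_graph A G \<longleftrightarrow>
     (\<forall>H. pair_graph H \<and> subgraph (with_proj H) (with_proj G) \<and> pverts H \<noteq> {} \<longrightarrow>
       (\<exists>v\<in>pverts H.
         (\<Sum>w\<in>pverts H - neighbors H v.
           3 powr (real (card (neighbors H v \<inter> neighbors H w)) / 3)) \<le> A))"

text \<open>
  Cliques are nonempty vertex sets. This only matters for the graph without vertices, which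
  thereby has no maximal clique: in any other graph a maximal clique is nonempty anyway.
\<close>

definition is_clique :: "'a pair_pre_digraph \<Rightarrow> 'a set \<Rightarrow> bool" where
  "is_clique G K \<longleftrightarrow>
     K \<noteq> {} \<and> K \<subseteq> pverts G \<and> (\<forall>u\<in>K. \<forall>v\<in>K. u \<noteq> v \<longrightarrow> (u, v) \<in> parcs G)"

definition maximal_clique :: "'a pair_pre_digraph \<Rightarrow> 'a set \<Rightarrow> bool" where
  "maximal_clique G K \<longleftrightarrow> is_clique G K \<and> \<not> (\<exists>L. is_clique G L \<and> K \<subset> L)"

end

(* Fix v as in the definition of A-boundedness.  Its summand w = v alone gives 3^(deg v / 3) <= A.
   The maximal cliques avoiding v are maximal in G - v; those containing v correspond to maximal
   cliques of the neighbourhood of v, and by the Moon-Moser theorem there are at most 3^(deg v / 3)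
   of them.  So deleting v loses at most A maximal cliques, and A-boundedness is hereditary.
   For Moon-Moser itself take v of maximum degree d on m vertices: every maximal clique meets the
   k = m - d non-neighbours of v, so induction gives the bound k * 3^((m - k) / 3) <= 3^(m / 3). *)

theory Submission
  imports Defs
begin

text \<open>Here, unlike in \<^const>\<open>maximal_clique\<close>, the empty set counts as a clique, so that a graph
  without vertices has one maximal clique, in accordance with \<open>3\<^sup>0 = 1\<close> in the Moon-Moser bound.\<close>

definition max_cliques :: "'a rel \<Rightarrow> 'a set \<Rightarrow> 'a set set" where
  "max_cliques E V = {K. K \<subseteq> V \<and> (\<forall>u\<in>K. \<forall>v\<in>K. u \<noteq> v \<longrightarrow> (u, v) \<in> E) \<and>
     (\<forall>w\<in>V - K. \<exists>u\<in>K. (u, w) \<notin> E)}"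

lemma max_cliques_empty: "max_cliques E {} = {{}}"
  by (auto simp: max_cliques_def)

lemma finite_max_cliques: "finite V \<Longrightarrow> finite (max_cliques E V)"
  by (rule finite_subset[of _ "Pow V"]) (auto simp: max_cliques_def)

lemma max_cliques_avoiding:
  "{K \<in> max_cliques E V. v \<notin> K} \<subseteq> max_cliques E (V - {v})"
  unfolding max_cliques_def by auto

text \<open>Removing \<open>v\<close> is injective on the cliques through \<open>v\<close>. The
  result stays maximal inside the neighbourhood: a vertex \<open>w\<close> adjacent to
  \<open>v\<close> but outside \<open>K\<close> has a non-neighbour in \<open>K\<close>, and that
  cannot be \<open>v\<close>.\<close>

lemma card_max_cliques_containing:
  assumes "finite V" "irrefl E"
  shows "card {K \<in> max_cliques E V. v \<in> K} \<le> card (max_cliques E {w \<in> V. (v, w) \<in> E})"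
proof (rule card_inj_on_le)
  show "inj_on (\<lambda>K. K - {v}) {K \<in> max_cliques E V. v \<in> K}"
    by (auto simp: inj_on_def)
  show "finite (max_cliques E {w \<in> V. (v, w) \<in> E})"
    using assms by (simp add: finite_max_cliques)
  show "(\<lambda>K. K - {v}) ` {K \<in> max_cliques E V. v \<in> K} \<subseteq> max_cliques E {w \<in> V. (v, w) \<in> E}"
  proof (rule image_subsetI)
    fix K assume "K \<in> {K \<in> max_cliques E V. v \<in> K}"
    then have K: "K \<subseteq> V" "\<forall>a\<in>K. \<forall>b\<in>K. a \<noteq> b \<longrightarrow> (a, b) \<in> E"
      "\<forall>w\<in>V - K. \<exists>u\<in>K. (u, w) \<notin> E" "v \<in> K"
      by (auto simp: max_cliques_def)
    have "\<exists>u\<in>K - {v}. (u, w) \<notin> E" if "w \<in> V" "(v, w) \<in> E" "w \<notin> K - {v}" for w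
    proof -
      have "w \<in> V - K"
        using that assms(2) by (auto simp: irrefl_def)
      then obtain u where "u \<in> K" "(u, w) \<notin> E"
        using K(3) by blast
      then show ?thesis
        using that(2) by blast
    qed
    then show "K - {v} \<in> max_cliques E {w \<in> V. (v, w) \<in> E}"
      using K by (auto simp: max_cliques_def)
  qed
qed

text \<open>By irreflexivity \<open>v\<close> is its own non-neighbour, which settles the case
  \<open>v \<in> K\<close>; otherwise maximality of \<open>K\<close> supplies the non-neighbour that
  keeps \<open>v\<close> out.\<close>

lemma max_clique_meets_nonneighbors:
  assumes "sym E" "irrefl E" "v \<in> V" "K \<in> max_cliques E V"
  shows "\<exists>w\<in>V. (v, w) \<notin> E \<and> w \<in> K"
proof (cases "v \<in> K")
  case True
  then show ?thesis
    using assms(2,3) by (auto simp: irrefl_def)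
next
  case False
  then obtain u where "u \<in> K" "(u, v) \<notin> E"
    using assms(3,4) unfolding max_cliques_def by blast
  then show ?thesis
    using assms(1,4) by (auto simp: max_cliques_def dest: symD)
qed

text \<open>The integer form of k \<le> 3^(k/3), tight at k = 3. The induction starts there because
  the step (k+1)^3 \<le> 3 k^3 fails at k = 2.\<close>

lemma cube_le_power_3: "k ^ 3 \<le> (3::nat) ^ k"
proof (cases "k \<le> 2")
  case True
  then have "k = 0 \<or> k = 1 \<or> k = 2" by auto
  then show ?thesis by auto
next
  case False
  then have "3 \<le> k" by simp
  then show ?thesis
  proof (induction k rule: dec_induct)
    case (step k)
    have "3 * k ^ 2 + 3 * k + 1 \<le> 2 * k ^ 3"
    proof -
      have "3 * (k * k) \<le> k * (k * k)" "3 * 3 * k \<le> k * k * k"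
        using step.hyps(1) by (intro mult_right_mono mult_mono; simp)+
      then have "3 * k ^ 2 \<le> k ^ 3" "9 * k \<le> k ^ 3"
        by (simp_all add: power2_eq_square power3_eq_cube mult.assoc)
      then show ?thesis
        using step.hyps(1) by linarith
    qed
    then have "Suc k ^ 3 \<le> 3 * k ^ 3"
      by (simp add: power2_eq_square power3_eq_cube algebra_simps)
    then show ?case
      using step.IH by simp
  qed simp
qed

lemma le_3_powr_third: "real k \<le> 3 powr (real k / 3)"
proof -
  have "real k ^ 3 \<le> 3 ^ k"
    using cube_le_power_3[of k] by (metis of_nat_le_iff of_nat_numeral of_nat_power)
  also have "(3::real) ^ k = (3 powr (real k / 3)) ^ 3"
    by (simp add: powr_power powr_realpow)
  finally show ?thesis
    by (subst (asm) power_mono_iff) simp_all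
qed

theorem Moon_Moser:
  assumes "finite V" "sym E" "irrefl E"
  shows "real (card (max_cliques E V)) \<le> 3 powr (real (card V) / 3)"
  using assms(1)
proof (induction V rule: finite_psubset_induct)
  case (psubset V)
  define N where "N v = {w \<in> V. (v, w) \<in> E}" for v
  show ?case
  proof (cases "V = {}")
    case True
    then show ?thesis by (simp add: max_cliques_empty)
  next
    case False
    then obtain v where v: "v \<in> V" "\<And>w. w \<in> V \<Longrightarrow> card (N w) \<le> card (N v)"
      using psubset.hyps finite_has_maximal[of "(\<lambda>v. card (N v)) ` V"] by (force simp: not_le)
    have "max_cliques E V \<subseteq> (\<Union>w\<in>V - N v. {K \<in> max_cliques E V. w \<in> K})"
      using max_clique_meets_nonneighbors[OF assms(2,3) v(1)] unfolding N_def by blast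
    then have "card (max_cliques E V) \<le> card (\<Union>w\<in>V - N v. {K \<in> max_cliques E V. w \<in> K})"
      using psubset.hyps by (intro card_mono) (auto simp: finite_max_cliques)
    also have "\<dots> \<le> (\<Sum>w\<in>V - N v. card {K \<in> max_cliques E V. w \<in> K})"
      using psubset.hyps by (intro card_UN_le) auto
    finally have "real (card (max_cliques E V)) \<le>
        (\<Sum>w\<in>V - N v. real (card {K \<in> max_cliques E V. w \<in> K}))"
      by (simp flip: of_nat_sum)
    also have "\<dots> \<le> (\<Sum>w\<in>V - N v. 3 powr (real (card (N v)) / 3))"
    proof (rule sum_mono)
      fix w assume "w \<in> V - N v"
      then have "w \<in> V" by simp
      \<comment> \<open>Strict because \<open>w\<close> itself is missing from \<open>N w\<close>;
        this makes the induction hypothesis applicable.\<close>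
      have "N w \<subset> V"
        using \<open>w \<in> V\<close> assms(3) by (auto simp: N_def irrefl_def)
      have "real (card {K \<in> max_cliques E V. w \<in> K}) \<le> real (card (max_cliques E (N w)))"
        using card_max_cliques_containing[OF psubset.hyps assms(3)] by (simp add: N_def)
      also have "\<dots> \<le> 3 powr (real (card (N w)) / 3)"
        by (rule psubset.IH) fact
      also have "\<dots> \<le> 3 powr (real (card (N v)) / 3)"
        using v(2)[OF \<open>w \<in> V\<close>] by simp
      finally show "real (card {K \<in> max_cliques E V. w \<in> K}) \<le> 3 powr (real (card (N v)) / 3)" .
    qed
    also have "\<dots> = real (card (V - N v)) * 3 powr (real (card (N v)) / 3)"
      by simp
    \<comment> \<open>The factor k = \<open>card (V - N v)\<close> is absorbed by k \<le> 3^(k/3),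
      so that the exponents add up to \<open>card V / 3\<close>.\<close>
    also have "\<dots> \<le> 3 powr (real (card (V - N v)) / 3) * 3 powr (real (card (N v)) / 3)"
      by (intro mult_right_mono le_3_powr_third) simp
    also have "\<dots> = 3 powr (real (card (V - N v) + card (N v)) / 3)"
      by (simp add: add_divide_distrib powr_add)
    also have "card (V - N v) + card (N v) = card V"
    proof -
      have "N v \<subseteq> V" by (auto simp: N_def)
      then show ?thesis
        using psubset.hyps by (simp add: card_Diff_subset card_mono finite_subset)
    qed
    finally show ?thesis .
  qed
qed

text \<open>Induction deleting one vertex at a time; the hypothesis ranges over all \<open>W\<close>
  so that it survives deletion. The empty clique is discarded since it would make the count 1 for
  empty \<open>V\<close>, where the bound is 0.\<close>

lemma card_max_cliques_le:
  assumes "finite V" "sym E" "irrefl E"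
    and "\<And>W. W \<subseteq> V \<Longrightarrow> W \<noteq> {} \<Longrightarrow>
      \<exists>v\<in>W. 3 powr (real (card {w \<in> W. (v, w) \<in> E}) / 3) \<le> A"
  shows "real (card (max_cliques E V - {{}})) \<le> real (card V) * A"
  using assms(1,4)
proof (induction V rule: finite_psubset_induct)
  case (psubset V)
  show ?case
  proof (cases "V = {}")
    case True
    then show ?thesis by (simp add: max_cliques_empty)
  next
    case False
    then obtain v where v: "v \<in> V" "3 powr (real (card {w \<in> V. (v, w) \<in> E}) / 3) \<le> A"
      using psubset.prems by blast
    have "max_cliques E V - {{}} \<subseteq>
        {K \<in> max_cliques E V. v \<in> K} \<union> (max_cliques E (V - {v}) - {{}})"
      using max_cliques_avoiding[of E V v] by blast
    then have "card (max_cliques E V - {{}}) \<le>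
        card ({K \<in> max_cliques E V. v \<in> K} \<union> (max_cliques E (V - {v}) - {{}}))"
      using psubset.hyps by (intro card_mono) (auto simp: finite_max_cliques)
    also have "\<dots> \<le> card {K \<in> max_cliques E V. v \<in> K} + card (max_cliques E (V - {v}) - {{}})"
      by (rule card_Un_le)
    also have "card {K \<in> max_cliques E V. v \<in> K} \<le> card (max_cliques E {w \<in> V. (v, w) \<in> E})"
      using psubset.hyps assms(3) by (rule card_max_cliques_containing)
    finally have "real (card (max_cliques E V - {{}})) \<le>
        real (card (max_cliques E {w \<in> V. (v, w) \<in> E})) +
        real (card (max_cliques E (V - {v}) - {{}}))"
      by simp
    \<comment> \<open>Moon-Moser on the neighbourhood of \<open>v\<close>, whose bound is at most
      \<open>A\<close> by the choice of \<open>v\<close>.\<close>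
    moreover have "real (card (max_cliques E {w \<in> V. (v, w) \<in> E})) \<le> A"
      using Moon_Moser[of "{w \<in> V. (v, w) \<in> E}"] psubset.hyps assms(2,3) v(2) by fastforce
    moreover have "real (card (max_cliques E (V - {v}) - {{}})) \<le> real (card (V - {v})) * A"
      using v(1) psubset.prems by (intro psubset.IH) auto
    moreover have "card V = Suc (card (V - {v}))"
      using v(1) psubset.hyps by (metis card.remove)
    ultimately show ?thesis
      by (simp add: algebra_simps)
  qed
qed

text \<open>If every vertex of \<open>K\<close> were adjacent to some \<open>w\<close> outside,
  \<open>insert w K\<close> would be a larger clique; symmetry provides the arcs out of
  \<open>w\<close>.\<close>

lemma Collect_maximal_clique_subset:
  assumes "sym (parcs G)"
  shows "{K. maximal_clique G K} \<subseteq> max_cliques (parcs G) (pverts G) - {{}}"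
proof
  fix K assume "K \<in> {K. maximal_clique G K}"
  then have K: "is_clique G K" "\<And>L. is_clique G L \<Longrightarrow> \<not> K \<subset> L"
    by (auto simp: maximal_clique_def)
  have "\<exists>u\<in>K. (u, w) \<notin> parcs G" if w: "w \<in> pverts G - K" for w
  proof (rule ccontr)
    assume "\<not> (\<exists>u\<in>K. (u, w) \<notin> parcs G)"
    then have "is_clique G (insert w K)"
      using K(1) w assms by (auto simp: is_clique_def dest: symD)
    then show False
      using K(2) w by blast
  qed
  then show "K \<in> max_cliques (parcs G) (pverts G) - {{}}"
    using K(1) by (auto simp: max_cliques_def is_clique_def)
qed

theorem theoremC3:
  fixes A :: real and G :: "'a pair_pre_digraph" and n :: nat
  assumes "A \<ge> 0"
    and "pair_graph G"
    and "bounded_graph A G"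
    and "card (pverts G) = n"
  shows "real (card {K. maximal_clique G K}) \<le> real n * A"
proof -
  interpret pair_graph G by fact
  have fin: "finite (pverts G)"
    by (rule pair_finite_verts)
  have sym: "sym (parcs G)"
    using pair_sym_arcs by (simp add: symmetric_def)
  have irrefl: "irrefl (parcs G)"
    using no_loops' by (auto simp: irrefl_def)
  have "\<exists>v\<in>W. 3 powr (real (card {w \<in> W. (v, w) \<in> parcs G}) / 3) \<le> A"
    if W: "W \<subseteq> pverts G" "W \<noteq> {}" for W
  proof -
    \<comment> \<open>The induced subgraph on \<open>W\<close>, so that neighbourhoods in
      \<open>H\<close> are those of \<open>G\<close> cut down to \<open>W\<close>.\<close>
    define H where "H = \<lparr>pverts = W, parcs = parcs G \<inter> W \<times> W\<rparr>"
    have H: "pverts H = W" "parcs H = parcs G \<inter> W \<times> W"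
      by (simp_all add: H_def)
    have graph: "pair_graph H"
    proof
      show "finite (pverts H)" "finite (parcs H)"
        using W fin pair_finite_arcs by (auto simp: H finite_subset)
      show "symmetric H"
        using sym by (auto simp: symmetric_def sym_def H)
    qed (use no_loops' in \<open>auto simp: H\<close>)
    then interpret H: pair_graph H .
    have "subgraph (with_proj H) (with_proj G)"
      using W H.wf_digraph_axioms wf_digraph_axioms
      by (auto simp: subgraph_def compatible_def H)
    then obtain v where v: "v \<in> W" and le: "(\<Sum>w\<in>W - neighbors H v.
        3 powr (real (card (neighbors H v \<inter> neighbors H w)) / 3)) \<le> A"
      using assms(3) graph W(2) unfolding bounded_graph_def by (metis H(1))
    \<comment> \<open>The summand w = v occurs because \<open>v\<close> is not its own neighbour,
      and the other summands are nonnegative.\<close>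
    have "3 powr (real (card (neighbors H v \<inter> neighbors H v)) / 3) \<le>
        (\<Sum>w\<in>W - neighbors H v. 3 powr (real (card (neighbors H v \<inter> neighbors H w)) / 3))"
      using v W fin irrefl
      by (intro member_le_sum) (auto simp: neighbors_def H irrefl_def finite_subset)
    moreover have "neighbors H v = {w \<in> W. (v, w) \<in> parcs G}"
      using v by (auto simp: neighbors_def H)
    ultimately show ?thesis
      using v le by (intro bexI[of _ v]) simp_all
  qed
  then have "real (card (max_cliques (parcs G) (pverts G) - {{}})) \<le> real (card (pverts G)) * A"
    by (intro card_max_cliques_le fin sym irrefl)
  moreover have "card {K. maximal_clique G K} \<le> card (max_cliques (parcs G) (pverts G) - {{}})"
    using fin by (intro card_mono Collect_maximal_clique_subset sym)
      (simp add: finite_max_cliques)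
  ultimately show ?thesis
    using assms(4) of_nat_mono order_trans by blast
qed

end
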